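(* Let $k\ge3$ and let $G$ be a $k$-graph (not necessarily connected) with vertex set $\{1,\dots,n\}$ in which every vertex lies in at least one edge. Let $\mathcal A$ and $\mathcal Q$ be its adjacency and signless Laplacian tensors, and let $\lambda_1=\rho(\mathcal A)$ and $\nu_1=\rho(\mathcal Q)$. Then $$\lambda_1=\max\Big\{\mathcal Ax^k : x\in\mathbb R^n_+,\ \sum_{i=1}^n x_i^k=1\Big\}$$ and $$\nu_1=\max\Big\{\mathcal Qx^k : x\in\mathbb R^n_+,\ \sum_{i=1}^n x_i^k=1\Big\}.$$
   Context: A $k$-graph $G=(V,E)$ consists of a vertex set $V=\{1,\dots,n\}$ and a set $E$ of distinct $k$-element subsets of $V$ (edges). Standing assumption: every vertex lies in at least one edge. The degree $d_i$ of vertex $i$ is the number of edges containing $i$. The adjacency tensor $\mathcal A=(a_{i_1\cdots i_k})$ is the $k$th order $n$-dimensional symmetric tensor with $a_{i_1\cdots i_k}=\frac1{(k-1)!}$ if $\{i_1,\dots,i_k\}\in E$ (in particular the indices are then distinct), and $0$ otherwise. The degree tensor $\mathcal D$ is the $k$th order $n$-dimensional diagonal tensor with $i$th diagonal entry $d_i$. The signless Laplacian tensor is $\mathcal Q=\mathcal D+\mathcal A$. For a real $k$th order $n$-dimensional tensor $\mathcal T=(t_{i_1\cdots i_k})$ and $x\in\mathbb C^n$, $\mathcal Tx^k=\sum_{i_1,\dots,i_k=1}^n t_{i_1\cdots i_k}x_{i_1}\cdots x_{i_k}$, $\mathcal Tx^{k-1}$ is the vector with $i$th component $\sum_{i_2,\dots,i_k=1}^n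 t_{ii_2\cdots i_k}x_{i_2}\cdots x_{i_k}$, and $x^{[k-1]}$ is the vector with components $x_i^{k-1}$. A number $\lambda\in\mathbb C$ is an eigenvalue of $\mathcal T$ if there is a nonzero $x\in\mathbb C^n$ with $\mathcal Tx^{k-1}=\lambda x^{[k-1]}$. The spectral radius $\rho(\mathcal T)$ is the largest modulus of the eigenvalues of $\mathcal T$. $\mathbb R^n_+$ is the set of vectors in $\mathbb R^n$ with nonnegative components. *)

theory Defs
  imports "HOL-Analysis.Analysis"
begin

text \<open>
  The vertex set is an arbitrary finite (hence nonempty) type \<open>'n\<close>, so that \<open>n = CARD('n)\<close>;
  a hypergraph on it is given by its set of edges.
\<close>

definition k_graph :: "nat \<Rightarrow> 'n::finite set set \<Rightarrow> bool" where
  "k_graph k E \<longleftrightarrow> (\<forall>e\<in>E. card e = k)"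

definition degree_of :: "'n::finite set set \<Rightarrow> 'n \<Rightarrow> nat" where
  "degree_of E i = card {e \<in> E. i \<in> e}"

text \<open>
  A \<open>k\<close>th order tensor is a real function of index lists \<open>[i\<^sub>1, \<dots>, i\<^sub>k]\<close>; only its values on
  lists of length \<open>k\<close> are ever used.
\<close>

type_synonym 'n tensor = "'n list \<Rightarrow> real"

text \<open>
  If every edge has \<open>k\<close> elements and the index list has length \<open>k\<close>, then \<open>set is \<in> E\<close> forces
  the indices to be distinct.
\<close>

definition adjacency_tensor :: "nat \<Rightarrow> 'n::finite set set \<Rightarrow> 'n tensor" where
  "adjacency_tensor k E = (\<lambda>is. if set is \<in> E then 1 / fact (k - 1) else 0)"

definition degree_tensor :: "nat \<Rightarrow> 'n::finite set set \<Rightarrow> 'n tensor" where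
  "degree_tensor k E =
    (\<lambda>is. if is = replicate k (hd is) then real (degree_of E (hd is)) else 0)"

definition signless_laplacian_tensor :: "nat \<Rightarrow> 'n::finite set set \<Rightarrow> 'n tensor" where
  "signless_laplacian_tensor k E = (\<lambda>is. degree_tensor k E is + adjacency_tensor k E is)"

text \<open>\<open>tensor_form k T x\<close> is \<open>T x\<^sup>k\<close> and \<open>tensor_apply k T x\<close> is the vector \<open>T x\<^sup>k\<^sup>-\<^sup>1\<close>,
  both for real and for complex \<open>x\<close>.\<close>

definition tensor_form :: "nat \<Rightarrow> 'n::finite tensor \<Rightarrow> 'a::real_normed_field ^ 'n \<Rightarrow> 'a" where
  "tensor_form k T x =
    (\<Sum>is | length is = k. of_real (T is) * prod_list (map (\<lambda>i. x $ i) is))"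

definition tensor_apply ::
  "nat \<Rightarrow> 'n::finite tensor \<Rightarrow> 'a::real_normed_field ^ 'n \<Rightarrow> 'a ^ 'n" where
  "tensor_apply k T x =
    (\<chi> i. \<Sum>is | length is = k - 1. of_real (T (i # is)) * prod_list (map (\<lambda>j. x $ j) is))"

definition tensor_eigenvalue :: "nat \<Rightarrow> 'n::finite tensor \<Rightarrow> complex \<Rightarrow> bool" where
  "tensor_eigenvalue k T l \<longleftrightarrow>
    (\<exists>x :: complex ^ 'n. x \<noteq> 0 \<and> tensor_apply k T x = l *s (\<chi> i. (x $ i) ^ (k - 1)))"

text \<open>\<open>Greatest\<close> is unspecified when there is no largest modulus.\<close>

definition tensor_spectral_radius :: "nat \<Rightarrow> 'n::finite tensor \<Rightarrow> real" where
  "tensor_spectral_radius k T = (GREATEST r. \<exists>l. tensor_eigenvalue k T l \<and> r = cmod l)"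

definition is_maximum :: "real set \<Rightarrow> real \<Rightarrow> bool" where
  "is_maximum S m \<longleftrightarrow> m \<in> S \<and> (\<forall>s\<in>S. s \<le> m)"

end

theory Submission
  imports Defs
begin

text \<open>
  Both tensors are symmetric and nonnegative, and the result holds for every such tensor \<open>T\<close> of
  order \<open>k \<ge> 2\<close>. Let \<open>M\<close> be the maximum of \<open>T x\<^sup>k\<close> over the compact set of nonnegative \<open>x\<close> with
  \<open>\<Sum> x\<^sub>i\<^sup>k = 1\<close>. If \<open>l\<close> is an eigenvalue with eigenvector \<open>z\<close>, then taking moduli in the
  eigenvalue equation, multiplying by \<open>|z\<^sub>i|\<close> and summing gives
  \<open>|l| \<Sum> |z\<^sub>i|\<^sup>k \<le> T |z|\<^sup>k \<le> M \<Sum> |z\<^sub>i|\<^sup>k\<close>. Conversely, at a maximiser \<open>y\<close> the partial derivatives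
  of \<open>F x = M \<Sum> x\<^sub>i\<^sup>k - T x\<^sup>k\<close>, which is nonnegative on the orthant and vanishes at \<open>y\<close>, are
  nonnegative, and by Euler's identity \<open>\<Sum> y\<^sub>i \<partial>\<^sub>iF(y) = k F(y) = 0\<close>. So \<open>\<partial>\<^sub>iF(y) = 0\<close> if
  \<open>y\<^sub>i > 0\<close>. If \<open>y\<^sub>i = 0\<close>, then \<open>\<partial>\<^sub>iF(y) = - k (T y\<^sup>k\<^sup>-\<^sup>1)\<^sub>i \<le> 0\<close> because \<open>k \<ge> 2\<close>, so it
  vanishes as well, and \<open>y\<close> is an eigenvector for \<open>M\<close>.
\<close>

section \<open>Tensor forms as sums over index lists\<close>

lemma sum_lists_Suc:
  fixes f :: "'n::finite list \<Rightarrow> 'a::comm_monoid_add"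
  shows "(\<Sum>is | length is = Suc m. f is) = (\<Sum>a\<in>UNIV. \<Sum>is | length is = m. f (a # is))"
proof -
  have "(\<Sum>a\<in>UNIV. \<Sum>is | length is = m. f (a # is)) = 
        (\<Sum>(a, is)\<in>UNIV \<times> {is. length is = m}. f (a # is))"
    by (simp add: sum.cartesian_product)
  also have "\<dots> = (\<Sum>is | length is = Suc m. f is)"
    by (rule sum.reindex_bij_witness[where i = "\<lambda>is. (hd is, tl is)" and j = "\<lambda>(a, is). a # is"])
       (auto simp: length_Suc_conv)
  finally show ?thesis ..
qed

text \<open>Splitting off the first index gives this. It turns inequalities between components of
  \<open>tensor_apply\<close> into inequalities for the form, and applied to partial derivatives it
  yields Euler's identity.\<close>

lemma tensor_form_eq_sum_apply:
  assumes "k \<ge> 1"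
  shows "tensor_form k T x = (\<Sum>i\<in>UNIV. x $ i * tensor_apply k T x $ i)"
proof -
  obtain m where m: "k = Suc m" using assms by (cases k) auto
  show ?thesis
    by (simp add: m tensor_form_def tensor_apply_def sum_lists_Suc sum_distrib_left mult_ac)
qed

lemma prod_list_map_scale:
  fixes x :: "'a::comm_semiring_1 ^ 'n"
  shows "prod_list (map (\<lambda>i. (c *s x) $ i) is) = c ^ length is * prod_list (map (\<lambda>i. x $ i) is)"
  by (induction "is") (auto simp: mult_ac)

lemma tensor_form_scale: "tensor_form k T (c *s x) = c ^ k * tensor_form k T x"
  unfolding tensor_form_def prod_list_map_scale
  by (simp add: sum_distrib_left mult_ac)

lemma continuous_on_tensor_form:
  "continuous_on A (tensor_form k T :: 'a::real_normed_field ^ 'n::finite \<Rightarrow> 'a)"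
proof -
  have "continuous_on A (\<lambda>x :: 'a ^ 'n. prod_list (map (\<lambda>i. x $ i) is))" for "is"
    by (induction "is") (auto intro!: continuous_intros)
  then show ?thesis
    unfolding tensor_form_def[abs_def] by (intro continuous_intros) auto
qed

section \<open>Symmetric tensors and partial derivatives of their forms\<close>

definition symmetric_tensor :: "'n::finite tensor \<Rightarrow> bool" where
  "symmetric_tensor T \<longleftrightarrow> (\<forall>is js. mset is = mset js \<longrightarrow> T is = T js)"

lemma symmetric_tensor_Cons: "symmetric_tensor T \<Longrightarrow> symmetric_tensor (\<lambda>is. T (a # is))"
  by (auto simp: symmetric_tensor_def)

lemma symmetric_tensor_add:
  "symmetric_tensor S \<Longrightarrow> symmetric_tensor T \<Longrightarrow> symmetric_tensor (\<lambda>is. S is + T is)"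
  unfolding symmetric_tensor_def by (intro allI impI arg_cong2[where f = "(+)"]) blast+

lemma tensor_form_Suc:
  "tensor_form (Suc m) T x = (\<Sum>a\<in>UNIV. x $ a * tensor_form m (\<lambda>is. T (a # is)) x)"
  by (simp add: tensor_form_def sum_lists_Suc sum_distrib_left mult_ac)

lemma tensor_apply_nth: "tensor_apply k T x $ i = tensor_form (k - 1) (\<lambda>is. T (i # is)) x"
  by (simp add: tensor_apply_def tensor_form_def)

text \<open>Induction on the order, with \<open>T\<close> arbitrary because the hypothesis is
  applied to slices of \<open>T\<close>. After the first index is split off, the product rule gives
  one copy of the form of the slice at \<open>i\<close> from the coordinate factor and
  \<open>Suc m\<close> copies from the slices.\<close>

lemma DERIV_tensor_form_Suc:
  fixes y :: "real ^ 'n::finite"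
  assumes "symmetric_tensor T"
  shows "((\<lambda>t. tensor_form (Suc m) T (y + t *\<^sub>R axis i 1)) has_real_derivative
           real (Suc m) * tensor_form m (\<lambda>is. T (i # is)) y) (at 0)"
  using assms
proof (induction m arbitrary: T)
  case 0
  have "((\<lambda>t. \<Sum>a\<in>UNIV. (y $ a + t * axis i 1 $ a) * T [a]) has_real_derivative
          (\<Sum>a\<in>UNIV. axis i 1 $ a * T [a])) (at 0)"
    by (auto intro!: derivative_eq_intros)
  moreover have "(\<Sum>a\<in>UNIV. axis i 1 $ a * T [a]) = T [i]"
    by (simp add: axis_def if_distrib[where f = "\<lambda>z. z * _"] cong: if_cong)
  ultimately show ?case
    by (simp add: tensor_form_Suc) (simp add: tensor_form_def)
next
  case (Suc m)
  let ?T = "\<lambda>a is. T (a # is)"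
  let ?D = "\<lambda>a. real (Suc m) * tensor_form m (\<lambda>is. T (a # i # is)) y"
  have IH: "((\<lambda>t. tensor_form (Suc m) (?T a) (y + t *\<^sub>R axis i 1)) has_real_derivative ?D a) (at 0)" for a
    using Suc.IH[OF symmetric_tensor_Cons[OF Suc.prems]] .
  have "((\<lambda>t. \<Sum>a\<in>UNIV. (y $ a + t * axis i 1 $ a) *
            tensor_form (Suc m) (?T a) (y + t *\<^sub>R axis i 1)) has_real_derivative
          (\<Sum>a\<in>UNIV. axis i 1 $ a * tensor_form (Suc m) (?T a) y + y $ a * ?D a)) (at 0)"
    by (auto intro!: derivative_eq_intros IH sum.cong simp: mult_ac)
  moreover have "(\<Sum>a\<in>UNIV. axis i 1 $ a * tensor_form (Suc m) (?T a) y + y $ a * ?D a) =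
      real (Suc (Suc m)) * tensor_form (Suc m) (?T i) y"
  proof -
    \<comment> \<open>Swapping the first two indices makes the sum over \<open>a\<close> the
      first-index expansion of the form of the slice at \<open>i\<close>.\<close>
    have "T (a # i # is) = T (i # a # is)" for a "is"
      using Suc.prems unfolding symmetric_tensor_def by (metis add_mset_commute mset.simps(2))
    then have "(\<Sum>a\<in>UNIV. y $ a * ?D a) = real (Suc m) * tensor_form (Suc m) (?T i) y"
      by (simp add: tensor_form_Suc sum_distrib_left mult_ac)
    moreover have "(\<Sum>a\<in>UNIV. axis i 1 $ a * tensor_form (Suc m) (?T a) y) =
        tensor_form (Suc m) (?T i) y"
      by (simp add: axis_def if_distrib[where f = "\<lambda>z. z * _"] cong: if_cong)
    ultimately show ?thesis
      by (simp only: sum.distrib) (simp add: algebra_simps)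
  qed
  ultimately show ?case
    by (subst tensor_form_Suc) simp
qed

lemma DERIV_tensor_form:
  fixes y :: "real ^ 'n::finite"
  assumes "symmetric_tensor T" "k \<ge> 1"
  shows "((\<lambda>t. tensor_form k T (y + t *\<^sub>R axis i 1)) has_real_derivative
           real k * tensor_apply k T y $ i) (at 0)"
  using DERIV_tensor_form_Suc[OF assms(1), of "k - 1"] assms(2) by (simp add: tensor_apply_nth)

section \<open>The nonnegative unit sphere and homogeneity\<close>

definition nonneg_unit_sphere :: "nat \<Rightarrow> (real ^ 'n::finite) set" where
  "nonneg_unit_sphere k = {x. (\<forall>i. 0 \<le> x $ i) \<and> (\<Sum>i\<in>UNIV. (x $ i) ^ k) = 1}"

text \<open>Each summand is at most the whole sum 1, so the set lies in the unit cube; it is closed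
  because it is cut out by continuous conditions.\<close>

lemma compact_nonneg_unit_sphere:
  assumes "k \<ge> 1"
  shows "compact (nonneg_unit_sphere k :: (real ^ 'n::finite) set)"
proof -
  have "x $ i \<le> 1" if "x \<in> nonneg_unit_sphere k" for x :: "real ^ 'n" and i
  proof -
    have "(x $ i) ^ k \<le> (\<Sum>i\<in>UNIV. (x $ i) ^ k)"
      by (rule member_le_sum) (use that in \<open>auto simp: nonneg_unit_sphere_def\<close>)
    then have "(x $ i) ^ k \<le> 1 ^ k"
      using that by (simp add: nonneg_unit_sphere_def)
    then show ?thesis
      using assms that power_mono_iff[of "x $ i" 1 k] by (simp add: nonneg_unit_sphere_def)
  qed
  then have "nonneg_unit_sphere k \<subseteq> (cbox 0 1 :: (real ^ 'n) set)"
    by (auto simp: mem_box_cart nonneg_unit_sphere_def)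
  then have "bounded (nonneg_unit_sphere k :: (real ^ 'n) set)"
    using bounded_cbox bounded_subset by blast
  moreover have "closed (nonneg_unit_sphere k :: (real ^ 'n) set)"
    unfolding nonneg_unit_sphere_def
    by (intro closed_Collect_conj closed_Collect_all closed_Collect_le closed_Collect_eq
        continuous_intros)
  ultimately show ?thesis
    using compact_eq_bounded_closed by blast
qed

lemma nonneg_unit_sphere_nonempty:
  assumes "k \<ge> 1"
  shows "nonneg_unit_sphere k \<noteq> ({} :: (real ^ 'n::finite) set)"
proof -
  fix i :: 'n
  have "axis i 1 \<in> nonneg_unit_sphere k"
    using assms
    by (auto simp: nonneg_unit_sphere_def axis_def if_distrib[where f = "\<lambda>z. z ^ k"] zero_power
        cong: if_cong)
  then show ?thesis by auto
qed

text \<open>Both sides are homogeneous of degree \<open>k\<close>, so a nonzero \<open>x\<close> can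
  be rescaled onto the sphere by the \<open>k\<close>th root of its power sum; at
  \<open>x = 0\<close> both sides vanish.\<close>

lemma tensor_form_le_homogeneous:
  fixes T :: "'n::finite tensor" and x :: "real ^ 'n"
  assumes "k \<ge> 1" and max: "\<And>x. x \<in> nonneg_unit_sphere k \<Longrightarrow> tensor_form k T x \<le> M"
    and nonneg: "\<And>i. 0 \<le> x $ i"
  shows "tensor_form k T x \<le> M * (\<Sum>i\<in>UNIV. (x $ i) ^ k)"
proof (cases "x = 0")
  case True
  then have "tensor_form k T x = 0"
    using tensor_form_scale[of k T 0 0] assms(1) by (simp add: zero_power)
  then show ?thesis using True assms(1) by (simp add: zero_power)
next
  case False
  define s where "s = (\<Sum>i\<in>UNIV. (x $ i) ^ k)"
  define c where "c = root k s"
  obtain i where "x $ i \<noteq> 0" using False by (auto simp: vec_eq_iff)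
  then have "0 < (x $ i) ^ k" using nonneg[of i] by simp
  also have "\<dots> \<le> s" unfolding s_def
    by (rule member_le_sum) (use nonneg in auto)
  finally have "s > 0" .
  then have c: "c > 0" "c ^ k = s" using assms(1) by (auto simp: c_def)
  have "(1 / c) *s x \<in> nonneg_unit_sphere k"
    using c nonneg \<open>s > 0\<close>
    by (auto simp: nonneg_unit_sphere_def power_divide s_def simp flip: sum_divide_distrib)
  from max[OF this] have "(1 / c) ^ k * tensor_form k T x \<le> M"
    by (simp only: tensor_form_scale)
  then show ?thesis
    using c \<open>s > 0\<close> by (simp add: power_divide field_simps flip: s_def)
qed

section \<open>Maximisers are eigenvectors\<close>

lemma tensor_apply_nonneg:
  fixes x :: "real ^ 'n::finite"
  assumes "\<And>is. 0 \<le> T is" "\<And>i. 0 \<le> x $ i"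
  shows "0 \<le> tensor_apply k T x $ i"
  using assms by (auto simp: tensor_apply_def intro!: sum_nonneg mult_nonneg_nonneg prod_list_nonneg)

text \<open>By homogeneity \<open>y\<close> minimises \<open>F\<close> on the whole orthant, not
  only on the sphere. One-sided moves along the coordinate axes therefore suffice, and no Lagrange
  multipliers are involved.\<close>

lemma maximiser_eigenvector:
  fixes T :: "'n::finite tensor" and y :: "real ^ 'n"
  assumes k: "k \<ge> 2" and T: "symmetric_tensor T" "\<And>is. 0 \<le> T is"
    and y: "y \<in> nonneg_unit_sphere k"
    and max: "\<And>x. x \<in> nonneg_unit_sphere k \<Longrightarrow> tensor_form k T x \<le> tensor_form k T y"
  shows "tensor_apply k T y $ i = tensor_form k T y * (y $ i) ^ (k - 1)"
proof -
  define M where "M = tensor_form k T y"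
  define F where "F x = M * (\<Sum>j\<in>UNIV. (x $ j) ^ k) - tensor_form k T x" for x :: "real ^ 'n"
  \<comment> \<open>\<open>D j\<close> is the partial derivative of \<open>F\<close> at
    \<open>y\<close> in direction \<open>j\<close>.\<close>
  define D where "D j = real k * (M * (y $ j) ^ (k - 1) - tensor_apply k T y $ j)" for j
  have k1: "k \<ge> 1" using k by simp
  have y0: "0 \<le> y $ j" for j using y by (simp add: nonneg_unit_sphere_def)
  have y1: "(\<Sum>j\<in>UNIV. (y $ j) ^ k) = 1" using y by (simp add: nonneg_unit_sphere_def)
  have D_nonneg: "0 \<le> D j" for j
  proof (rule ccontr)
    assume neg: "\<not> 0 \<le> D j"
    have "((\<lambda>t. \<Sum>l\<in>UNIV. (y $ l + t * axis j 1 $ l) ^ k) has_real_derivative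
            (\<Sum>l\<in>UNIV. real k * axis j 1 $ l * (y $ l) ^ (k - 1))) (at 0)"
      by (auto intro!: derivative_eq_intros sum.cong simp: mult_ac)
    moreover have "(\<Sum>l\<in>UNIV. real k * axis j 1 $ l * (y $ l) ^ (k - 1)) =
        real k * (y $ j) ^ (k - 1)"
      by (simp add: axis_def if_distrib[where f = "\<lambda>z. _ * z"] if_distrib[where f = "\<lambda>z. z * _"]
          cong: if_cong)
    ultimately have "((\<lambda>t. F (y + t *\<^sub>R axis j 1)) has_real_derivative D j) (at 0)"
      unfolding F_def
      by (auto intro!: derivative_eq_intros DERIV_tensor_form[OF T(1) k1] simp: D_def algebra_simps)
    \<comment> \<open>A negative derivative would push \<open>F\<close> below \<open>F y = 0\<close>
      for small positive steps, and such steps stay in the orthant even when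
      \<open>y $ j = 0\<close>.\<close>
    from DERIV_neg_dec_right[OF this] neg obtain d where d: "d > 0"
      "\<And>h. 0 < h \<Longrightarrow> h < d \<Longrightarrow> F (y + h *\<^sub>R axis j 1) < F y"
      by force
    have "F (y + (d / 2) *\<^sub>R axis j 1) < F y" using d by simp
    also have "F y = 0" by (simp add: F_def y1 M_def)
    finally have "F (y + (d / 2) *\<^sub>R axis j 1) < 0" .
    moreover have "0 \<le> F (y + (d / 2) *\<^sub>R axis j 1)"
      using tensor_form_le_homogeneous[OF k1 max, of "y + (d / 2) *\<^sub>R axis j 1"] y0 d(1)
      by (simp add: F_def M_def axis_def)
    ultimately show False by simp
  qed
  \<comment> \<open>Euler's identity for \<open>F\<close> at \<open>y\<close>; since its terms are
    nonnegative, each of them vanishes.\<close>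
  have "(\<Sum>j\<in>UNIV. y $ j * D j) =
      real k * (M * (\<Sum>j\<in>UNIV. y $ j * (y $ j) ^ (k - 1)) - tensor_form k T y)"
    by (simp add: D_def tensor_form_eq_sum_apply[OF k1] sum_distrib_left sum_subtractf
        right_diff_distrib mult_ac)
  also have "(\<Sum>j\<in>UNIV. y $ j * (y $ j) ^ (k - 1)) = 1"
    using k1 y1 by (simp flip: power_Suc)
  finally have "(\<Sum>j\<in>UNIV. y $ j * D j) = 0" by (simp add: M_def)
  then have "y $ i * D i = 0"
    using D_nonneg y0 by (subst (asm) sum_nonneg_eq_0_iff) auto
  \<comment> \<open>Here \<open>k \<ge> 2\<close> gives \<open>0 ^ (k - 1) = 0\<close>, which leaves
    only the nonpositive term of \<open>D i\<close>.\<close>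
  moreover have "D i \<le> 0" if "y $ i = 0"
    using that k tensor_apply_nonneg[of T y k i] T(2) y0
    by (simp add: D_def zero_power mult_nonneg_nonneg)
  ultimately have "D i = 0" using D_nonneg[of i] by force
  then show ?thesis using k by (simp add: D_def M_def)
qed

section \<open>Bounding eigenvalues and identifying the spectral radius\<close>

lemma tensor_apply_of_real:
  fixes y :: "real ^ 'n::finite"
  shows "tensor_apply k T (\<chi> i. complex_of_real (y $ i)) $ i = of_real (tensor_apply k T y $ i)"
proof -
  have "prod_list (map (\<lambda>i. complex_of_real (y $ i)) is) =
      of_real (prod_list (map (\<lambda>i. y $ i) is))" for "is"
    by (induction "is") auto
  then show ?thesis by (simp add: tensor_apply_def)
qed

text \<open>The triangle inequality, with entries of \<open>T\<close> equal to their own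
  moduli.\<close>

lemma norm_tensor_apply_le:
  fixes z :: "'a::real_normed_field ^ 'n::finite"
  assumes "\<And>is. 0 \<le> T is"
  shows "norm (tensor_apply k T z $ i) \<le> tensor_apply k T (\<chi> i. norm (z $ i)) $ i"
proof -
  have "norm (prod_list (map (\<lambda>i. z $ i) is)) = prod_list (map (\<lambda>i. norm (z $ i)) is)" for "is"
    by (induction "is") (auto simp: norm_mult)
  then show ?thesis
    using assms by (auto simp: tensor_apply_def norm_mult intro!: sum_norm_le)
qed

lemma tensor_eigenvalue_norm_le:
  fixes T :: "'n::finite tensor"
  assumes k: "k \<ge> 1" and T: "\<And>is. 0 \<le> T is"
    and max: "\<And>x. x \<in> nonneg_unit_sphere k \<Longrightarrow> tensor_form k T x \<le> M"
    and "tensor_eigenvalue k T l"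
  shows "cmod l \<le> M"
proof -
  obtain z :: "complex ^ 'n" where z: "z \<noteq> 0"
    "tensor_apply k T z = l *s (\<chi> i. (z $ i) ^ (k - 1))"
    using assms(4) by (auto simp: tensor_eigenvalue_def)
  define w :: "real ^ 'n" where "w = (\<chi> i. cmod (z $ i))"
  define s where "s = (\<Sum>i\<in>UNIV. (w $ i) ^ k)"
  obtain i where "z $ i \<noteq> 0" using z(1) by (auto simp: vec_eq_iff)
  then have "0 < (w $ i) ^ k" by (simp add: w_def)
  also have "\<dots> \<le> s" unfolding s_def
    by (rule member_le_sum) (auto simp: w_def)
  finally have "s > 0" .
  have le: "cmod l * (w $ i) ^ (k - 1) \<le> tensor_apply k T w $ i" for i
    using norm_tensor_apply_le[of T k z i] T z(2) by (simp add: w_def norm_mult norm_power)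
  have "cmod l * s = (\<Sum>i\<in>UNIV. w $ i * (cmod l * (w $ i) ^ (k - 1)))"
    using k by (simp add: s_def sum_distrib_left mult.left_commute flip: power_Suc)
  also have "\<dots> \<le> (\<Sum>i\<in>UNIV. w $ i * tensor_apply k T w $ i)"
    by (intro sum_mono mult_left_mono le) (simp add: w_def)
  also have "\<dots> = tensor_form k T w" by (simp add: tensor_form_eq_sum_apply[OF k])
  also have "\<dots> \<le> M * s" unfolding s_def
    by (rule tensor_form_le_homogeneous[OF k max]) (auto simp: w_def)
  finally show ?thesis using \<open>s > 0\<close> by simp
qed

lemma spectral_radius_is_maximum:
  fixes T :: "'n::finite tensor"
  assumes k: "k \<ge> 2" and T: "symmetric_tensor T" "\<And>is. 0 \<le> T is"
  shows "is_maximum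
           {tensor_form k T x | x :: real ^ 'n.
              (\<forall>i. 0 \<le> x $ i) \<and> (\<Sum>i\<in>UNIV. (x $ i) ^ k) = 1}
           (tensor_spectral_radius k T)"
proof -
  have k1: "k \<ge> 1" using k by simp
  obtain y :: "real ^ 'n" where y: "y \<in> nonneg_unit_sphere k"
    and max: "\<And>x. x \<in> nonneg_unit_sphere k \<Longrightarrow> tensor_form k T x \<le> tensor_form k T y"
    using continuous_attains_sup[OF compact_nonneg_unit_sphere[OF k1]
        nonneg_unit_sphere_nonempty[OF k1] continuous_on_tensor_form] by metis
  define M where "M = tensor_form k T y"
  have y0: "0 \<le> y $ i" for i using y by (simp add: nonneg_unit_sphere_def)
  \<comment> \<open>The spectral radius is a modulus, so the sign is needed to identify
    \<open>cmod (of_real M)\<close> with \<open>M\<close>.\<close>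
  have "M \<ge> 0"
    unfolding M_def tensor_form_eq_sum_apply[OF k1]
    using tensor_apply_nonneg[of T y k] T(2) y0 by (intro sum_nonneg mult_nonneg_nonneg) auto
  have "y \<noteq> 0"
    using y k1 by (auto simp: nonneg_unit_sphere_def zero_power)
  then have "tensor_eigenvalue k T (of_real M)"
    unfolding tensor_eigenvalue_def
    using maximiser_eigenvector[OF k T y max]
    by (intro exI[of _ "\<chi> i. complex_of_real (y $ i)"])
       (auto simp: vec_eq_iff tensor_apply_of_real M_def)
  \<comment> \<open>The value \<open>M\<close> is attained as a modulus and bounds all others, so
    \<open>Greatest\<close> is determined here.\<close>
  then have "tensor_spectral_radius k T = M"
    unfolding tensor_spectral_radius_def
    using tensor_eigenvalue_norm_le[OF k1 T(2) max] \<open>M \<ge> 0\<close>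
    by (intro Greatest_equality) (force simp: M_def)+
  then show ?thesis
    using y max by (auto simp: is_maximum_def nonneg_unit_sphere_def M_def)
qed

section \<open>Symmetry of the hypergraph tensors\<close>

lemma symmetric_adjacency_tensor: "symmetric_tensor (adjacency_tensor k E)"
  by (auto simp: symmetric_tensor_def adjacency_tensor_def dest: mset_eq_setD)

lemma symmetric_degree_tensor:
  assumes "k \<ge> 1"
  shows "symmetric_tensor (degree_tensor k E)"
proof -
  \<comment> \<open>A permutation of a constant list is the same list, so both lists are diagonal
    with the same entry or neither is diagonal.\<close>
  have "js = is" if "mset is = mset js" "is = replicate k a" for a :: 'n and "is" js
  proof -
    have "mset js = replicate_mset k a" using that by simp
    then have "size (mset js) = k" "set_mset (mset js) \<subseteq> {a}" by auto
    then have "length js = k" "set js \<subseteq> {a}" by auto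
    then show ?thesis using that(2) by (metis replicate_eqI singletonD subsetD)
  qed
  then show ?thesis
    unfolding symmetric_tensor_def degree_tensor_def by metis
qed

theorem theorem11:
  fixes k :: nat and E :: "'n::finite set set"
  assumes "k \<ge> 3"
    and "k_graph k E"
    and "\<forall>i::'n. \<exists>e\<in>E. i \<in> e"
  shows "is_maximum
           {tensor_form k (adjacency_tensor k E) x | x :: real ^ 'n.
              (\<forall>i. 0 \<le> x $ i) \<and> (\<Sum>i\<in>UNIV. (x $ i) ^ k) = 1}
           (tensor_spectral_radius k (adjacency_tensor k E))
       \<and> is_maximum
           {tensor_form k (signless_laplacian_tensor k E) x | x :: real ^ 'n.
              (\<forall>i. 0 \<le> x $ i) \<and> (\<Sum>i\<in>UNIV. (x $ i) ^ k) = 1}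
           (tensor_spectral_radius k (signless_laplacian_tensor k E))"
proof -
  have k: "k \<ge> 2" "k \<ge> 1" using assms(1) by simp_all
  have "symmetric_tensor (signless_laplacian_tensor k E)"
    unfolding signless_laplacian_tensor_def
    by (rule symmetric_tensor_add) (use k in \<open>auto intro: symmetric_adjacency_tensor symmetric_degree_tensor\<close>)
  then show ?thesis
    by (intro conjI spectral_radius_is_maximum k symmetric_adjacency_tensor)
       (simp_all add: signless_laplacian_tensor_def degree_tensor_def adjacency_tensor_def)
qed

end
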